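(* Let $m,n$ be positive integers with $m$ even, $n$ odd and $m>n$. Then, with the notation of the context: (i) If $m\ge 2n$, then for every $(a,b,c)\in\mathbb R^3$, $$ |||(a,b,c)|||_{m,n}=\begin{cases} \left|K_{m,n}\,a\left|\frac{b}{a}\right|^{\frac{m}{n}}-c\right| & \text{if } abc\neq 0 \text{ and } \left(\frac{b}{a},\frac{nb}{mc}\right)\in\mathcal A_{m,n},\\[4pt] \left|K_{m,m-n}\,c\left|\frac{b}{c}\right|^{\frac{m}{m-n}}-a\right| & \text{if } abc\neq 0 \text{ and } \left(\frac{b}{a},\frac{nb}{mc}\right)\in\mathcal B_{m,n},\\[4pt] \max\{|a|,|c|\} & \text{if } b=0 \text{ and } ac\le 0,\\ |a+c|+|b| & \text{otherwise.} \end{cases} $$ (ii) If $m<2n$, then $|||(a,b,c)|||_{m,n}=|||(c,b,a)|||_{m,m-n}$ for every $(a,b,c)\in\mathbb R^3$ (and the right-hand side is given by (i), applied with $m-n$ in place of $n$).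
   Context: Norm: for integers $m>n\ge1$ and $(a,b,c)\in\mathbb R^3$, $$|||(a,b,c)|||_{m,n}=\sup\{|ax^m+bx^{m-n}y^n+cy^m| : (x,y)\in[-1,1]^2\}.$$ Constants: for integers $m>n\geq 1$, $K_{m,n}=\frac{n}{m-n}\left(\frac{m-n}{m}\right)^{m/n}$ (so $K_{m,m-n}=\frac{m-n}{n}\left(\frac nm\right)^{m/(m-n)}$). Now let $m$ be even, $n$ odd, $m\ge 2n$. Convention: since $m$ is even and $m-n$ is odd, $t^{m/(m-n)}$ for real $t$ (possibly negative) is the real power with odd denominator, i.e. $t^{m/(m-n)}=|t|^{m/(m-n)}$. For $b\in[0,\frac{m}{m-n}]$, $\Lambda_{m,n}(b)$ denotes the unique non-positive real solution $t$ of $$mK_{m,n}\,t\,b^{m/n}-nb-mt+(m-n)\,b\,t^{\frac{m}{m-n}}=0;$$ the function $\Lambda_{m,n}$ is strictly decreasing with $\Lambda_{m,n}(0)=0$. Put $\tau_0=\Lambda_{m,n}\left(\frac{m}{m-n}\right)$, and for $t\in[-1,0]$ put $$g(t)=\frac{2mt}{(m-n)t^{\frac{m}{m-n}}+mt-n}.$$ Regions: $$\mathcal A^1_{m,n}=\{(b,t)\in\mathbb R^2: b\in(0,\tfrac{m}{m-n}],\ \Lambda_{m,n}(b)\le t<0\},$$ $$\mathcal B^1_{m,n}=\{(b,t)\in\mathbb R^2: b\in(0,\tfrac{m}{m-n}],\ \tau_0\le t\le\Lambda_{m,n}(b)\}\cup\{(b,t)\in\mathbb R^2: t\in[-1,\tau_0],\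 0<b\le g(t)\},$$ $\mathcal A^2_{m,n}=-\mathcal A^1_{m,n}$, $\mathcal B^2_{m,n}=-\mathcal B^1_{m,n}$, $\mathcal A_{m,n}=\mathcal A^1_{m,n}\cup\mathcal A^2_{m,n}$, $\mathcal B_{m,n}=\mathcal B^1_{m,n}\cup\mathcal B^2_{m,n}$. *)

theory Defs
  imports "HOL-Analysis.Analysis"
begin

text \<open>
  The parameters are naturals \<open>m > n \<ge> 1\<close>, so that the truncated difference \<open>m - n\<close> is the
  actual one and \<open>real (m - n) = real m - real n\<close>.
\<close>

definition trinomial_norm :: "nat \<Rightarrow> nat \<Rightarrow> real \<times> real \<times> real \<Rightarrow> real" where
  "trinomial_norm m n = (\<lambda>(a, b, c).
     SUP (x, y) \<in> {-1..1} \<times> {-1..1}. \<bar>a * x ^ m + b * x ^ (m - n) * y ^ n + c * y ^ m\<bar>)"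

definition K_const :: "nat \<Rightarrow> nat \<Rightarrow> real" where
  "K_const m n = real n / real (m - n) * (real (m - n) / real m) powr (real m / real n)"

text \<open>
  For \<open>m\<close> even and \<open>m - n\<close> odd, \<open>t\<close> to the power \<open>m / (m - n)\<close> is a power with even numerator and
  odd denominator, hence equal to that of \<open>\<bar>t\<bar>\<close>. HOL's \<open>powr\<close> does not follow this
  convention at negative bases, so the absolute value is written out.
\<close>

definition odd_denom_pow :: "nat \<Rightarrow> nat \<Rightarrow> real \<Rightarrow> real" where
  "odd_denom_pow m n t = \<bar>t\<bar> powr (real m / real (m - n))"

text \<open>Only meaningful for \<open>0 \<le> b \<le> m / (m - n)\<close>, where the solution exists and is unique.\<close>

definition Lambda_fun :: "nat \<Rightarrow> nat \<Rightarrow> real \<Rightarrow> real" where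
  "Lambda_fun m n b = (THE t. t \<le> 0 \<and>
     real m * K_const m n * t * b powr (real m / real n) - real n * b - real m * t
       + real (m - n) * b * odd_denom_pow m n t = 0)"

definition tau0 :: "nat \<Rightarrow> nat \<Rightarrow> real" where
  "tau0 m n = Lambda_fun m n (real m / real (m - n))"

definition g_fun :: "nat \<Rightarrow> nat \<Rightarrow> real \<Rightarrow> real" where
  "g_fun m n t = 2 * real m * t / (real (m - n) * odd_denom_pow m n t + real m * t - real n)"

definition region_A1 :: "nat \<Rightarrow> nat \<Rightarrow> (real \<times> real) set" where
  "region_A1 m n = {(b, t). b \<in> {0<..real m / real (m - n)} \<and> Lambda_fun m n b \<le> t \<and> t < 0}"

definition region_B1 :: "nat \<Rightarrow> nat \<Rightarrow> (real \<times> real) set" where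
  "region_B1 m n =
     {(b, t). b \<in> {0<..real m / real (m - n)} \<and> tau0 m n \<le> t \<and> t \<le> Lambda_fun m n b} \<union>
     {(b, t). t \<in> {-1..tau0 m n} \<and> 0 < b \<and> b \<le> g_fun m n t}"

definition region_A :: "nat \<Rightarrow> nat \<Rightarrow> (real \<times> real) set" where
  "region_A m n = region_A1 m n \<union> uminus ` region_A1 m n"

definition region_B :: "nat \<Rightarrow> nat \<Rightarrow> (real \<times> real) set" where
  "region_B m n = region_B1 m n \<union> uminus ` region_B1 m n"

text \<open>
  The two regions overlap along the graph of \<open>Lambda_fun\<close>. The value \<open>v\<close> is therefore required to
  agree with every case that applies, rather than giving one of the cases priority.
\<close>

definition norm_cases :: "nat \<Rightarrow> nat \<Rightarrow> real \<times> real \<times> real \<Rightarrow> real \<Rightarrow> bool" where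
  "norm_cases m n = (\<lambda>(a, b, c) v.
     let in_A = a * b * c \<noteq> 0 \<and> (b / a, real n * b / (real m * c)) \<in> region_A m n;
         in_B = a * b * c \<noteq> 0 \<and> (b / a, real n * b / (real m * c)) \<in> region_B m n;
         zero_mid = b = 0 \<and> a * c \<le> 0
     in (in_A \<longrightarrow> v = \<bar>K_const m n * a * \<bar>b / a\<bar> powr (real m / real n) - c\<bar>) \<and>
        (in_B \<longrightarrow> v = \<bar>K_const m (m - n) * c * \<bar>b / c\<bar> powr (real m / real (m - n)) - a\<bar>) \<and>
        (zero_mid \<longrightarrow> v = max \<bar>a\<bar> \<bar>c\<bar>) \<and>
        (\<not> in_A \<and> \<not> in_B \<and> \<not> zero_mid \<longrightarrow> v = \<bar>a + c\<bar> + \<bar>b\<bar>))"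

end

theory Submission
  imports Defs
begin

text \<open>
  Scaling and the symmetry \<open>x \<mapsto> - x\<close> reduce the case \<open>ac < 0\<close>, \<open>b \<noteq> 0\<close> to the trinomial
  \<open>x\<^sup>m + b x\<^sup>p y\<^sup>n - d y\<^sup>m\<close> with \<open>p = m - n\<close> and \<open>b, d > 0\<close>; otherwise the triangle inequality
  is sharp or \<open>b = 0\<close>. Weighted AM-GM gives its exact minimum \<open>- (d + K b\<^sup>m\<^sup>/\<^sup>n)\<close> when \<open>p b \<le> m\<close> and
  \<open>1 - b - d\<close> otherwise, and its exact maximum \<open>1 + K' d (b/d)\<^sup>m\<^sup>/\<^sup>p\<close> when \<open>n b \<le> m d\<close> and
  \<open>1 + b - d\<close> otherwise. The regions decide which of the two absolute values is larger: with
  \<open>u = n b / (m d)\<close>, the left-hand side of the equation defining \<open>\<Lambda>\<close> at \<open>t = - u\<close> is \<open>m u\<close> times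
  the difference of the two interior extremal values, and \<open>b \<le> g(- u)\<close> compares the interior maximum
  with \<open>b + d - 1\<close>.
\<close>

section \<open>Weighted AM-GM and the constant K\<close>

lemma weighted_AM_GM_powers:
  fixes x y :: real
  assumes "0 < p" "0 < n" "0 \<le> x" "0 \<le> y"
  shows "real (p + n) * (x ^ p * y ^ n) \<le> real p * x ^ (p + n) + real n * y ^ (p + n)"
proof -
  have pow: "(z ^ (p + n)) powr (real k / real (p + n)) = z ^ k" if "0 \<le> z" "0 < k" for z :: real and k
  proof (cases "z = 0")
    case False
    then show ?thesis using that assms(1)
      by (simp add: powr_realpow[symmetric] powr_powr)
  qed (use that assms(1) in \<open>auto simp: power_0_left\<close>)
  have "(x ^ (p + n)) powr (real p / real (p + n)) * (y ^ (p + n)) powr (real n / real (p + n))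
      \<le> real p / real (p + n) * x ^ (p + n) + real n / real (p + n) * y ^ (p + n)"
  proof (cases "x = 0 \<or> y = 0")
    case False
    then show ?thesis
      using assms by (intro Youngs_inequality_0) (auto simp: add_divide_distrib[symmetric])
  qed (use assms in \<open>auto simp: power_0_left\<close>)
  then have "x ^ p * y ^ n \<le> (real p * x ^ (p + n) + real n * y ^ (p + n)) / real (p + n)"
    unfolding pow[OF assms(3,1)] pow[OF assms(4,2)]
    by (simp only: add_divide_distrib times_divide_eq_left)
  then show ?thesis
    using assms(1) by (simp add: field_simps)
qed

text \<open>\<open>r\<close> is the positive zero of the derivative of
  \<open>b * x ^ p - x ^ (p + n)\<close> in \<open>x\<close>, and the term with
  \<open>K_const\<close> is the value there. The next lemma, at \<open>y = 1\<close>, shows that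
  this value is the maximum over nonnegative \<open>x\<close>.\<close>

lemma K_const_critical_point:
  fixes b :: real
  assumes "0 < p" "0 < n" "0 < b"
  obtains r where "0 < r" "r ^ n = real p * b / real (p + n)"
    "K_const (p + n) n * b powr (real (p + n) / real n) = b * r ^ p - r ^ (p + n)"
proof
  define r where "r = (real p * b / real (p + n)) powr (1 / real n)"
  have pos: "0 < real p * b / real (p + n)"
    using assms by simp
  show "0 < r"
    using pos unfolding r_def by (simp only: powr_gt_zero)
  show rn: "r ^ n = real p * b / real (p + n)"
    using pos assms by (simp add: r_def powr_realpow[symmetric] powr_powr del: powr_mult)
  have rm: "r ^ (p + n) = (real p * b / real (p + n)) powr (real (p + n) / real n)"
    using pos assms by (simp add: r_def powr_realpow[symmetric] powr_powr del: powr_mult of_nat_add)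
  have "K_const (p + n) n * b powr (real (p + n) / real n) =
     real n / real p *
       ((real p / real (p + n)) powr (real (p + n) / real n) * b powr (real (p + n) / real n))"
    by (simp add: K_const_def)
  also have "\<dots> = real n / real p * r ^ (p + n)"
    using assms by (simp add: rm powr_mult[symmetric] del: powr_mult)
  also have "\<dots> = b * r ^ p - r ^ (p + n)"
  proof -
    \<comment> \<open>The critical equation, rearranged and multiplied by \<open>r ^ p\<close>,
      expresses \<open>n * r ^ (p + n)\<close> through the value of the function at
      \<open>r\<close>.\<close>
    have "real (p + n) * r ^ n = real p * b"
      unfolding rn using assms by simp
    then have "real n * r ^ n = real p * b - real p * r ^ n"
      by (simp add: algebra_simps)
    then have "real n * r ^ n * r ^ p = (real p * b - real p * r ^ n) * r ^ p"
      by (simp only:)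
    then show ?thesis
      using assms by (simp add: field_simps power_add)
  qed
  finally show "K_const (p + n) n * b powr (real (p + n) / real n) = b * r ^ p - r ^ (p + n)" .
qed

text \<open>AM-GM is applied to \<open>x\<close> and \<open>r * y\<close> with \<open>r\<close> the
  critical point, so that equality falls on the ray \<open>x = r * y\<close>. The critical equation
  turns the coefficient of the mixed term into \<open>p * b\<close>.\<close>

lemma K_const_upper_bound:
  fixes b x y :: real
  assumes "0 < p" "0 < n" "0 < b" "0 \<le> x" "0 \<le> y"
  shows "b * (x ^ p * y ^ n) \<le>
    x ^ (p + n) + K_const (p + n) n * b powr (real (p + n) / real n) * y ^ (p + n)"
proof -
  obtain r where r: "0 < r" "r ^ n = real p * b / real (p + n)"
    "K_const (p + n) n * b powr (real (p + n) / real n) = b * r ^ p - r ^ (p + n)"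
    using K_const_critical_point[OF assms(1-3)] .
  let ?m = "real (p + n)"
  have b: "?m * r ^ n = real p * b"
    using r(2) assms by simp
  have "r ^ n * (real p * (b * (x ^ p * y ^ n))) = r ^ n * (?m * (x ^ p * (r * y) ^ n))"
    using b by (simp add: power_mult_distrib)
  also have "\<dots> \<le> r ^ n * (real p * x ^ (p + n) + real n * (r * y) ^ (p + n))"
    using weighted_AM_GM_powers[of p n x "r * y"] assms r(1) by (intro mult_left_mono) auto
  also have "\<dots> = r ^ n * (real p * (x ^ (p + n) + (b * r ^ p - r ^ (p + n)) * y ^ (p + n)))"
  proof -
    have "real n * (r * y) ^ (p + n) = (?m * r ^ n - real p * r ^ n) * r ^ p * y ^ (p + n)"
      by (simp add: power_mult_distrib power_add algebra_simps)
    also have "\<dots> = real p * ((b * r ^ p - r ^ (p + n)) * y ^ (p + n))"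
      unfolding b by (simp add: power_add algebra_simps)
    finally show ?thesis by (simp only: distrib_left)
  qed
  finally show ?thesis
    unfolding r(3) using r(1) assms(1) by simp
qed

section \<open>The norm as a maximum, its scaling and its symmetries\<close>

lemma trinomial_norm_eqI:
  assumes "\<And>x y. x \<in> {-1..1} \<Longrightarrow> y \<in> {-1..1} \<Longrightarrow>
      \<bar>a * x ^ m + b * x ^ (m - n) * y ^ n + c * y ^ m\<bar> \<le> v"
    and "x \<in> {-1..1}" "y \<in> {-1..1}" "\<bar>a * x ^ m + b * x ^ (m - n) * y ^ n + c * y ^ m\<bar> = v"
  shows "trinomial_norm m n (a, b, c) = v"
  unfolding trinomial_norm_def prod.case
  by (rule cSup_eq_maximum) (use assms in \<open>force+\<close>)

text \<open>Continuity on a compact square. With a maximizer at hand, scaling and symmetry only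
  require moving that point and the upper bound.\<close>

lemma trinomial_norm_attained:
  obtains x y where "x \<in> {-1..1}" "y \<in> {-1..1}"
    "trinomial_norm m n (a, b, c) = \<bar>a * x ^ m + b * x ^ (m - n) * y ^ n + c * y ^ m\<bar>"
    "\<And>x y. x \<in> {-1..1} \<Longrightarrow> y \<in> {-1..1} \<Longrightarrow>
      \<bar>a * x ^ m + b * x ^ (m - n) * y ^ n + c * y ^ m\<bar> \<le> trinomial_norm m n (a, b, c)"
proof -
  let ?f = "\<lambda>z :: real \<times> real. \<bar>a * fst z ^ m + b * fst z ^ (m - n) * snd z ^ n + c * snd z ^ m\<bar>"
  have "\<exists>z\<in>{-1..1} \<times> {-1..1}. \<forall>w\<in>{-1..1} \<times> {-1..1}. ?f w \<le> ?f z"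
    by (rule continuous_attains_sup) (auto intro!: compact_Times continuous_intros)
  then obtain x y where xy: "x \<in> {-1..1}" "y \<in> {-1..1}"
    and ub: "\<And>x' y'. x' \<in> {-1..1} \<Longrightarrow> y' \<in> {-1..1} \<Longrightarrow> ?f (x', y') \<le> ?f (x, y)"
    by blast
  moreover have "trinomial_norm m n (a, b, c) = ?f (x, y)"
    by (rule trinomial_norm_eqI[OF _ xy]) (use ub in auto)
  ultimately show ?thesis
    by (intro that[of x y]) auto
qed

lemma trinomial_norm_scale:
  "trinomial_norm m n (k * a, k * b, k * c) = \<bar>k\<bar> * trinomial_norm m n (a, b, c)"
proof -
  have scale: "\<bar>k * a * x ^ m + k * b * x ^ (m - n) * y ^ n + k * c * y ^ m\<bar> =
      \<bar>k\<bar> * \<bar>a * x ^ m + b * x ^ (m - n) * y ^ n + c * y ^ m\<bar>" for x y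
    by (simp add: abs_mult[symmetric] algebra_simps)
  obtain x y where "x \<in> {-1..1}" "y \<in> {-1..1}"
    "trinomial_norm m n (a, b, c) = \<bar>a * x ^ m + b * x ^ (m - n) * y ^ n + c * y ^ m\<bar>"
    "\<And>x y. x \<in> {-1..1} \<Longrightarrow> y \<in> {-1..1} \<Longrightarrow>
      \<bar>a * x ^ m + b * x ^ (m - n) * y ^ n + c * y ^ m\<bar> \<le> trinomial_norm m n (a, b, c)"
    using trinomial_norm_attained[of m n a b c] by blast
  then show ?thesis
    by (intro trinomial_norm_eqI[where x = x and y = y]) (auto simp: scale intro!: mult_left_mono)
qed

lemma trinomial_norm_uminus_mid:
  assumes "even m" "odd (m - n)"
  shows "trinomial_norm m n (a, - b, c) = trinomial_norm m n (a, b, c)"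
proof -
  obtain x y where xy: "x \<in> {-1..1}" "y \<in> {-1..1}"
    "trinomial_norm m n (a, b, c) = \<bar>a * x ^ m + b * x ^ (m - n) * y ^ n + c * y ^ m\<bar>"
    and ub: "\<And>x y. x \<in> {-1..1} \<Longrightarrow> y \<in> {-1..1} \<Longrightarrow>
      \<bar>a * x ^ m + b * x ^ (m - n) * y ^ n + c * y ^ m\<bar> \<le> trinomial_norm m n (a, b, c)"
    using trinomial_norm_attained[of m n a b c] by blast
  show ?thesis
    using assms xy ub[of "- x" y for x y]
    by (intro trinomial_norm_eqI[where x = "- x" and y = y]) auto
qed

lemma trinomial_norm_swap:
  assumes "n \<le> m"
  shows "trinomial_norm m n (a, b, c) = trinomial_norm m (m - n) (c, b, a)"
proof -
  obtain x y where "x \<in> {-1..1}" "y \<in> {-1..1}"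
    "trinomial_norm m (m - n) (c, b, a) = \<bar>c * x ^ m + b * x ^ (m - (m - n)) * y ^ (m - n) + a * y ^ m\<bar>"
    "\<And>x y. x \<in> {-1..1} \<Longrightarrow> y \<in> {-1..1} \<Longrightarrow>
      \<bar>c * x ^ m + b * x ^ (m - (m - n)) * y ^ (m - n) + a * y ^ m\<bar> \<le> trinomial_norm m (m - n) (c, b, a)"
    using trinomial_norm_attained[of m "m - n" c b a] by blast
  then show ?thesis
    using assms by (intro trinomial_norm_eqI[where x = y and y = x]) (auto simp: algebra_simps)
qed

section \<open>Extremal values of the normalized trinomial\<close>

text \<open>Naming \<open>p\<close> for \<open>m - n\<close> lets part (ii) reuse everything with
  \<open>n\<close> and \<open>m - n\<close> exchanged; \<open>n_le_p\<close> is the condition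
  \<open>2 * n \<le> m\<close>.\<close>

locale odd_split =
  fixes m n p :: nat
  assumes m_eq: "m = p + n" and odd_n: "odd n" and odd_p: "odd p" and n_le_p: "n \<le> p"
begin

lemma n_pos: "0 < n" and p_pos: "0 < p"
  using odd_n odd_p by (auto elim: oddE)

lemma m_pos: "0 < m" and m_minus_n: "m - n = p" and m_minus_p: "m - p = n" and even_m: "even m"
  using n_pos odd_n odd_p by (auto simp: m_eq)

lemma real_m: "real m = real p + real n"
  by (simp add: m_eq)

text \<open>For \<open>x ^ m + b * x ^ p * y ^ n - d * y ^ m\<close>, \<open>lower_val\<close> is
  minus the value at the critical point \<open>(- r, 1)\<close> of the edge line
  \<open>y = 1\<close>, and \<open>upper_val\<close> is the value at the critical point
  \<open>(1, s)\<close> of \<open>x = 1\<close>.\<close>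

definition lower_val :: "real \<Rightarrow> real \<Rightarrow> real" where
  "lower_val b d = d + K_const m n * b powr (real m / real n)"

definition upper_val :: "real \<Rightarrow> real \<Rightarrow> real" where
  "upper_val b d = 1 + K_const m p * d * (b / d) powr (real m / real p)"

text \<open>Since \<open>r ^ n = p * b / m\<close> and \<open>s ^ p = n * b / (m * d)\<close>, the
  two conditions say that the critical point lies in the square. Otherwise the corner
  \<open>(-1, 1)\<close>, respectively \<open>(1, 1)\<close>, takes over.\<close>

definition lower_max :: "real \<Rightarrow> real \<Rightarrow> real" where
  "lower_max b d = (if real p * b \<le> real m then lower_val b d else b + d - 1)"

definition upper_max :: "real \<Rightarrow> real \<Rightarrow> real" where
  "upper_max b d = (if real n * b \<le> real m * d then upper_val b d else 1 + b - d)"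

lemma lower_val_bound:
  assumes "0 < b" "0 \<le> x" "0 \<le> y"
  shows "b * (x ^ p * y ^ n) \<le> x ^ m + (lower_val b d - d) * y ^ m"
  using K_const_upper_bound[OF p_pos n_pos assms]
  unfolding m_eq[symmetric] lower_val_def by simp

text \<open>The same bound with \<open>x\<close>, \<open>y\<close> and \<open>p\<close>,
  \<open>n\<close> exchanged, for the coefficient \<open>b / d\<close>, multiplied by
  \<open>d\<close>.\<close>

lemma upper_val_bound:
  assumes "0 < b" "0 < d" "0 \<le> x" "0 \<le> y"
  shows "b * (x ^ p * y ^ n) \<le> d * y ^ m + (upper_val b d - 1) * x ^ m"
proof -
  have "b / d * (y ^ n * x ^ p) \<le> y ^ m + K_const m p * (b / d) powr (real m / real p) * x ^ m"
    using K_const_upper_bound[OF n_pos p_pos, of "b / d" y x] assms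
    unfolding add.commute[of n p] m_eq[symmetric] by simp
  then have "d * (b / d * (y ^ n * x ^ p)) \<le>
      d * (y ^ m + K_const m p * (b / d) powr (real m / real p) * x ^ m)"
    using assms by (intro mult_left_mono) auto
  then show ?thesis
    using assms by (simp add: upper_val_def algebra_simps)
qed

lemma lower_val_ge: "0 < b \<Longrightarrow> b + d - 1 \<le> lower_val b d"
  using lower_val_bound[of b 1 1 d] by simp

lemma upper_val_ge: "0 < b \<Longrightarrow> 0 < d \<Longrightarrow> 1 + b - d \<le> upper_val b d"
  using upper_val_bound[of b d 1 1] by simp

lemma lower_max_ge: "0 < b \<Longrightarrow> b + d - 1 \<le> lower_max b d"
  using lower_val_ge by (simp add: lower_max_def)

lemma upper_max_ge: "0 < b \<Longrightarrow> 0 < d \<Longrightarrow> 1 + b - d \<le> upper_max b d"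
  using upper_val_ge by (simp add: upper_max_def)

lemma lower_max_bound:
  assumes "0 < b" "0 < d" "0 \<le> x" "x \<le> 1" "0 \<le> y" "y \<le> 1"
  shows "b * (x ^ p * y ^ n) + d * y ^ m - x ^ m \<le> lower_max b d"
proof (cases "real p * b \<le> real m")
  case True
  have "0 \<le> lower_val b d"
    using assms by (simp add: lower_val_def K_const_def)
  then have "lower_val b d * y ^ m \<le> lower_val b d"
    using assms by (simp add: mult_left_le power_le_one)
  then show ?thesis
    using True lower_val_bound[of b x y d] assms by (simp add: lower_max_def algebra_simps)
next
  case False
  \<comment> \<open>AM-GM leaves an expression linear in \<open>x ^ m\<close> and
    \<open>y ^ m\<close>. As \<open>p * b > m\<close>, both coefficients are positive, so its
    maximum is at \<open>x = y = 1\<close>, where AM-GM is an equality.\<close>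
  have "real m * (b * (x ^ p * y ^ n) - x ^ m) \<le> (real p * b - real m) * x ^ m + real n * b * y ^ m"
    using mult_left_mono[OF weighted_AM_GM_powers[OF p_pos n_pos assms(3,5)], of b] assms(1)
    by (simp add: m_eq algebra_simps)
  also have "\<dots> \<le> (real p * b - real m) * 1 + real n * b * y ^ m"
    using False assms by (intro add_mono mult_left_mono) (auto simp: power_le_one)
  finally have "real m * (b * (x ^ p * y ^ n) + d * y ^ m - x ^ m) \<le>
      real p * b - real m + (real n * b + real m * d) * y ^ m"
    by (simp add: algebra_simps)
  also have "\<dots> \<le> real p * b - real m + (real n * b + real m * d)"
    using assms by (auto simp: power_le_one intro!: mult_left_le)
  also have "\<dots> = real m * (b + d - 1)"
    by (simp add: real_m algebra_simps)
  finally show ?thesis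
    using False m_pos by (simp add: lower_max_def)
qed

lemma upper_max_bound:
  assumes "0 < b" "0 < d" "0 \<le> x" "x \<le> 1" "0 \<le> y" "y \<le> 1"
  shows "x ^ m + b * (x ^ p * y ^ n) - d * y ^ m \<le> upper_max b d"
proof (cases "real n * b \<le> real m * d")
  case True
  have "0 \<le> upper_val b d"
    using assms by (simp add: upper_val_def K_const_def)
  then have "upper_val b d * x ^ m \<le> upper_val b d"
    using assms by (simp add: mult_left_le power_le_one)
  then show ?thesis
    using True upper_val_bound[of b d x y] assms by (simp add: upper_max_def algebra_simps)
next
  case False
  \<comment> \<open>Again linear after AM-GM, now with \<open>n * b - m * d > 0\<close> as the
    coefficient of \<open>y ^ m\<close>.\<close>
  have "real m * (b * (x ^ p * y ^ n) - d * y ^ m) \<le> (real n * b - real m * d) * y ^ m + real p * b * x ^ m"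
    using mult_left_mono[OF weighted_AM_GM_powers[OF p_pos n_pos assms(3,5)], of b] assms(1)
    by (simp add: m_eq algebra_simps)
  also have "\<dots> \<le> (real n * b - real m * d) * 1 + real p * b * x ^ m"
    using False assms by (intro add_mono mult_left_mono) (auto simp: power_le_one)
  finally have "real m * (x ^ m + b * (x ^ p * y ^ n) - d * y ^ m) \<le>
      real n * b - real m * d + (real p * b + real m) * x ^ m"
    by (simp add: algebra_simps)
  also have "\<dots> \<le> real n * b - real m * d + (real p * b + real m)"
    using assms by (auto simp: power_le_one intro!: mult_left_le)
  also have "\<dots> = real m * (1 + b - d)"
    by (simp add: real_m algebra_simps)
  finally show ?thesis
    using False m_pos by (simp add: upper_max_def)
qed

lemma lower_max_attained:
  assumes "0 < b"
  obtains r where "0 \<le> r" "r \<le> 1" "b * r ^ p + d - r ^ m = lower_max b d"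
proof (cases "real p * b \<le> real m")
  case True
  obtain r where r: "0 < r" "r ^ n = real p * b / real m"
    "K_const m n * b powr (real m / real n) = b * r ^ p - r ^ m"
    using K_const_critical_point[OF p_pos n_pos assms] unfolding m_eq by blast
  have "r ^ n \<le> 1"
    using True m_pos r(2) by simp
  then have "r \<le> 1"
    using r(1) n_pos by (simp add: power_le_one_iff)
  then show ?thesis
    using that[of r] r True by (simp add: lower_max_def lower_val_def)
qed (use that[of 1] in \<open>simp add: lower_max_def\<close>)

lemma upper_max_attained:
  assumes "0 < b" "0 < d"
  obtains s where "0 \<le> s" "s \<le> 1" "1 + b * s ^ n - d * s ^ m = upper_max b d"
proof (cases "real n * b \<le> real m * d")
  case True
  obtain s where s: "0 < s" "s ^ p = real n * (b / d) / real m"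
    "K_const m p * (b / d) powr (real m / real p) = b / d * s ^ n - s ^ m"
    using K_const_critical_point[OF n_pos p_pos, of "b / d"] assms
    unfolding m_eq add.commute[of p n] by auto
  have "s ^ p \<le> 1"
    using True m_pos assms unfolding s(2) by (simp add: field_simps)
  then have "s \<le> 1"
    using s(1) p_pos by (simp add: power_le_one_iff)
  moreover have "upper_val b d = 1 + d * (b / d * s ^ n - s ^ m)"
    unfolding upper_val_def s(3)[symmetric] by simp
  ultimately show ?thesis
    using that[of s] s True assms by (simp add: upper_max_def algebra_simps)
qed (use that[of 1] in \<open>simp add: upper_max_def\<close>)

lemma trinomial_norm_eq_max:
  assumes "0 < b" "0 < d"
  shows "trinomial_norm m n (1, b, - d) = max (lower_max b d) (upper_max b d)"
proof (rule antisym)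
  obtain x y where xy: "x \<in> {-1..1}" "y \<in> {-1..1}" and
    "trinomial_norm m n (1, b, - d) = \<bar>1 * x ^ m + b * x ^ (m - n) * y ^ n + - d * y ^ m\<bar>"
    and ub: "\<And>x y. x \<in> {-1..1} \<Longrightarrow> y \<in> {-1..1} \<Longrightarrow>
      \<bar>1 * x ^ m + b * x ^ (m - n) * y ^ n + - d * y ^ m\<bar> \<le> trinomial_norm m n (1, b, - d)"
    using trinomial_norm_attained[of m n 1 b "- d"] by blast
  then have norm: "trinomial_norm m n (1, b, - d) = \<bar>x ^ m + b * (x ^ p * y ^ n) - d * y ^ m\<bar>"
    by (simp add: m_minus_n)
  \<comment> \<open>As \<open>m\<close> is even, signs of \<open>x\<close> and \<open>y\<close>
    affect only the mixed term, so both the trinomial and its negative are bounded by their worst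
    cases at \<open>\<bar>x\<bar>\<close>, \<open>\<bar>y\<bar>\<close>.\<close>
  have abs: "\<bar>x\<bar> ^ m = x ^ m" "\<bar>y\<bar> ^ m = y ^ m"
    using even_m by (simp_all add: power_even_abs)
  have mid: "\<bar>b * (x ^ p * y ^ n)\<bar> = b * (\<bar>x\<bar> ^ p * \<bar>y\<bar> ^ n)"
    using assms by (simp add: abs_mult power_abs)
  show "trinomial_norm m n (1, b, - d) \<le> max (lower_max b d) (upper_max b d)"
    using lower_max_bound[of b d "\<bar>x\<bar>" "\<bar>y\<bar>"] upper_max_bound[of b d "\<bar>x\<bar>" "\<bar>y\<bar>"] assms xy mid
    unfolding norm abs atLeastAtMost_iff by (simp add: abs_le_iff) linarith
  obtain r where r: "0 \<le> r" "r \<le> 1" "b * r ^ p + d - r ^ m = lower_max b d"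
    using lower_max_attained[OF assms(1)] .
  obtain s where s: "0 \<le> s" "s \<le> 1" "1 + b * s ^ n - d * s ^ m = upper_max b d"
    using upper_max_attained[OF assms] .
  \<comment> \<open>The sign in \<open>- r\<close> makes the mixed term negative because
    \<open>p\<close> is odd.\<close>
  show "max (lower_max b d) (upper_max b d) \<le> trinomial_norm m n (1, b, - d)"
    using ub[of "- r" 1] ub[of 1 s] r s odd_p even_m by (auto simp: m_minus_n)
qed

section \<open>Comparison of the extremal values, and the curves \<open>Lambda_fun\<close> and
  \<open>g_fun\<close>\<close>

text \<open>The left-hand side of the equation that defines \<open>\<Lambda>(b)\<close>, at \<open>t = - u\<close>.\<close>

definition gap :: "real \<Rightarrow> real \<Rightarrow> real" where
  "gap b u = real p * b * u powr (real m / real p)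
     + real m * u * (1 - K_const m n * b powr (real m / real n)) - real n * b"

text \<open>\<open>u\<close> is \<open>s ^ p\<close> for the critical point \<open>(1, s)\<close>,
  so \<open>u \<le> 1\<close> means that this point lies in the square. The powers in
  \<open>upper_val\<close> combine into \<open>u powr (m / p)\<close>, and
  \<open>m * u * d = n * b\<close> eliminates \<open>d\<close>.\<close>

lemma gap_eq_val_diff:
  assumes "0 < b" "0 < d" "u = real n * b / (real m * d)"
  shows "gap b u = real m * u * (upper_val b d - lower_val b d)"
    and "real m * u * (upper_val b d - 1) = real p * b * u powr (real m / real p)"
    and "real m * u * d = real n * b"
proof -
  show d: "real m * u * d = real n * b"
    using assms m_pos by simp
  have "(real n / real m) powr (real m / real p) * (b / d) powr (real m / real p)
      = (real n / real m * (b / d)) powr (real m / real p)"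
    using assms by (subst powr_mult) auto
  also have "real n / real m * (b / d) = u"
    using assms by simp
  finally have "real n * (upper_val b d - 1) = real p * d * u powr (real m / real p)"
    using n_pos by (simp add: upper_val_def K_const_def m_minus_p)
  then have "real m * u * (real n * (upper_val b d - 1)) =
      real m * u * (real p * d * u powr (real m / real p))"
    by simp
  also have "\<dots> = real n * (real p * b * u powr (real m / real p))"
    using d by (simp add: algebra_simps)
  finally show u: "real m * u * (upper_val b d - 1) = real p * b * u powr (real m / real p)"
    using n_pos by (simp add: mult.left_commute)
  show "gap b u = real m * u * (upper_val b d - lower_val b d)"
    unfolding gap_def u[symmetric] d[symmetric] lower_val_def by (simp add: algebra_simps)
qed

text \<open>The term equals \<open>r ^ p * (b - r ^ n)\<close> with
  \<open>b - r ^ n = n * b / m\<close>, and \<open>r \<le> 1\<close>. The second bound uses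
  \<open>n_le_p\<close>; it makes the coefficient of \<open>u\<close> in \<open>gap\<close>
  nonnegative, hence \<open>gap\<close> increasing.\<close>

lemma K_const_term_le:
  assumes "0 < b" "real p * b \<le> real m"
  shows "K_const m n * b powr (real m / real n) \<le> real n * b / real m"
    and "K_const m n * b powr (real m / real n) \<le> 1"
proof -
  obtain r where r: "0 < r" "r ^ n = real p * b / real m"
    "K_const m n * b powr (real m / real n) = b * r ^ p - r ^ m"
    using K_const_critical_point[OF p_pos n_pos assms(1)] unfolding m_eq by blast
  have "r ^ n \<le> 1"
    using assms m_pos r(2) by simp
  then have "r ^ p \<le> 1"
    using r(1) n_pos p_pos by (simp add: power_le_one_iff)
  have "b * r ^ p - r ^ m = r ^ p * (b - r ^ n)"
    by (simp add: m_eq power_add algebra_simps)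
  also have "b - r ^ n = real n * b / real m"
    unfolding r(2) using m_pos by (simp add: field_simps) (simp add: real_m algebra_simps)
  also have "r ^ p * (real n * b / real m) \<le> real n * b / real m"
    using \<open>r ^ p \<le> 1\<close> r(1) assms(1) by (intro mult_left_le_one_le) auto
  finally show "K_const m n * b powr (real m / real n) \<le> real n * b / real m"
    by (simp only: r(3))
  also have "\<dots> \<le> real n / real p"
    using assms mult_left_mono[OF assms(2), of "real n"] m_pos p_pos by (simp add: field_simps)
  also have "\<dots> \<le> 1"
    using n_le_p p_pos by simp
  finally show "K_const m n * b powr (real m / real n) \<le> 1" .
qed

lemma K_const_term_end: "K_const m n * (real m / real p) powr (real m / real n) = real n / real p"
proof -
  have "(real p / real m) powr (real m / real n) * (real m / real p) powr (real m / real n) = 1"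
    using m_pos p_pos by (subst powr_mult[symmetric]) auto
  then show ?thesis
    by (simp add: K_const_def m_minus_n)
qed

lemma gap_strict_mono:
  assumes "0 < b" "real p * b \<le> real m" "0 \<le> u" "u < v"
  shows "gap b u < gap b v"
proof -
  have "real p * b * u powr (real m / real p) < real p * b * v powr (real m / real p)"
    using assms m_pos p_pos by (intro mult_strict_left_mono powr_less_mono2) auto
  moreover have "real m * u * (1 - K_const m n * b powr (real m / real n))
      \<le> real m * v * (1 - K_const m n * b powr (real m / real n))"
    using assms K_const_term_le(2)[OF assms(1,2)] by (intro mult_right_mono mult_left_mono) auto
  ultimately show ?thesis
    by (simp add: gap_def)
qed

lemma gap_le_iff:
  assumes "0 < b" "real p * b \<le> real m" "0 \<le> u" "0 \<le> v"
  shows "gap b u \<le> gap b v \<longleftrightarrow> u \<le> v"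
  using gap_strict_mono[OF assms(1,2)] assms(3,4)
  by (metis linorder_not_le order_less_asym order.order_iff_strict)

text \<open>Together with \<open>gap b 0 < 0\<close> this puts the root of \<open>gap b\<close> in
  (0, 1]. It also confines \<open>region_A1\<close> to \<open>u \<le> 1\<close>.\<close>

lemma gap_one_nonneg:
  assumes "0 < b" "real p * b \<le> real m"
  shows "0 \<le> gap b 1"
proof -
  have "real n * b \<le> real p * b"
    using assms n_le_p by (intro mult_right_mono) auto
  moreover have "0 \<le> real m * (1 - K_const m n * b powr (real m / real n))"
    using K_const_term_le(2)[OF assms] by simp
  ultimately show ?thesis
    by (simp add: gap_def)
qed

lemma Lambda_fun_root:
  assumes "0 < b" "real p * b \<le> real m"
  obtains v where "0 < v" "v \<le> 1" "gap b v = 0" "Lambda_fun m n b = - v"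
proof -
  have "gap b 0 < 0"
    using assms n_pos by (simp add: gap_def)
  moreover have "continuous_on {0..1} (gap b)"
    unfolding gap_def using m_pos p_pos by (intro continuous_intros continuous_on_powr') auto
  ultimately obtain v where v: "0 \<le> v" "v \<le> 1" "gap b v = 0"
    using IVT'[of "gap b" 0 0 1] gap_one_nonneg[OF assms] by auto
  have "v \<noteq> 0"
    using \<open>gap b 0 < 0\<close> v(3) by auto
  \<comment> \<open>Substituting \<open>t = - u\<close> removes the absolute value in
    \<open>odd_denom_pow\<close>; uniqueness of the root is then strict monotonicity of
    \<open>gap\<close>.\<close>
  have eq: "real m * K_const m n * t * b powr (real m / real n) - real n * b - real m * t
       + real (m - n) * b * odd_denom_pow m n t = gap b (- t)" if "t \<le> 0" for t
    using that by (simp add: gap_def odd_denom_pow_def m_minus_n algebra_simps)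
  have "Lambda_fun m n b = - v"
    unfolding Lambda_fun_def
  proof (rule the_equality)
    fix t
    assume t: "t \<le> 0 \<and> real m * K_const m n * t * b powr (real m / real n) - real n * b - real m * t
       + real (m - n) * b * odd_denom_pow m n t = 0"
    then have "gap b (- t) = gap b v"
      using eq[of t] v(3) by (simp only:)
    then show "t = - v"
      using gap_le_iff[OF assms, of "- t" v] gap_le_iff[OF assms, of v "- t"] t v(1) by simp
  qed (use v eq[of "- v"] in simp)
  then show ?thesis
    using that[of v] v \<open>v \<noteq> 0\<close> by simp
qed

lemma Lambda_fun_le_iff:
  assumes "0 < b" "real p * b \<le> real m" "0 \<le> u"
  shows "Lambda_fun m n b \<le> - u \<longleftrightarrow> gap b u \<le> 0" "- u \<le> Lambda_fun m n b \<longleftrightarrow> 0 \<le> gap b u"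
proof -
  obtain v where "0 < v" "v \<le> 1" "gap b v = 0" "Lambda_fun m n b = - v"
    using Lambda_fun_root[OF assms(1,2)] .
  then show "Lambda_fun m n b \<le> - u \<longleftrightarrow> gap b u \<le> 0" "- u \<le> Lambda_fun m n b \<longleftrightarrow> 0 \<le> gap b u"
    using gap_le_iff[OF assms(1,2), of u v] gap_le_iff[OF assms(1,2), of v u] assms(3) by auto
qed

lemma Lambda_fun_range:
  assumes "0 < b" "real p * b \<le> real m"
  shows "- 1 \<le> Lambda_fun m n b" "Lambda_fun m n b < 0"
  using Lambda_fun_root[OF assms] by (metis neg_le_iff_le, metis neg_less_0_iff_less)

lemma gap_end:
  "gap (real m / real p) u =
     real m / real p * (real p * u powr (real m / real p) + (real p - real n) * u - real n)"
  unfolding gap_def K_const_term_end using p_pos by (simp add: field_simps)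

lemma le_tau0_iff:
  assumes "0 \<le> u"
  shows "- u \<le> tau0 m n \<longleftrightarrow> real n \<le> real p * u powr (real m / real p) + (real p - real n) * u"
proof -
  have pos: "0 < real m / real p" "real p * (real m / real p) \<le> real m"
    using m_pos p_pos by auto
  show ?thesis
    unfolding tau0_def m_minus_n Lambda_fun_le_iff(2)[OF pos assms] gap_end using pos(1)
    by (subst zero_le_mult_iff) auto
qed

lemma tau0_range: "- 1 \<le> tau0 m n" "tau0 m n < 0"
  using Lambda_fun_range[of "real m / real p"] m_pos p_pos by (auto simp: tau0_def m_minus_n)

text \<open>In effect \<open>tau0\<close> is the least value of \<open>Lambda_fun\<close>. Bounding
  the K-term by \<open>n * b / m\<close> and \<open>m * u\<close> below by \<open>p * b * u\<close>
  leaves \<open>b\<close> times the bracket of \<open>gap_end\<close>, which is nonnegative left of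
  \<open>tau0\<close>.\<close>

lemma gap_nonneg_left_of_tau0:
  assumes "0 < b" "real p * b \<le> real m" "0 \<le> u" "- u \<le> tau0 m n"
  shows "0 \<le> gap b u"
proof -
  let ?q = "u powr (real m / real p)"
  have edge: "real n \<le> real p * ?q + (real p - real n) * u"
    using assms le_tau0_iff by simp
  have "real m * (K_const m n * b powr (real m / real n)) \<le> real n * b"
    using K_const_term_le(1)[OF assms(1,2)] m_pos by (simp add: field_simps)
  then have "u * (real m * (K_const m n * b powr (real m / real n))) \<le> u * (real n * b)"
    using assms(3) by (rule mult_left_mono)
  moreover have "u * (real p * b) \<le> u * real m"
    using assms(2,3) by (rule mult_left_mono)
  moreover have "b * real n \<le> b * (real p * ?q + (real p - real n) * u)"
    using edge assms(1) by (intro mult_left_mono) auto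
  ultimately show ?thesis
    unfolding gap_def by (simp add: algebra_simps)
qed

text \<open>The exponent \<open>m / p\<close> is at least 1, so
  \<open>u powr (m / p) \<le> u\<close> and the denominator of \<open>g_fun\<close> is
  negative.\<close>

lemma le_g_fun_iff:
  assumes "0 < u" "u \<le> 1"
  shows "b \<le> g_fun m n (- u) \<longleftrightarrow>
    b * (real m * u + real n - real p * u powr (real m / real p)) \<le> 2 * real m * u"
proof -
  have "u powr (real m / real p) \<le> u powr 1"
    using assms p_pos real_m by (intro powr_mono') auto
  then have "real p * u powr (real m / real p) \<le> real p * u"
    using assms by (intro mult_left_mono) auto
  moreover have "0 \<le> real n * u" "0 < real n"
    using assms n_pos by simp_all
  ultimately have pos: "0 < real m * u + real n - real p * u powr (real m / real p)" (is "0 < ?D")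
    by (simp add: real_m algebra_simps)
  have "g_fun m n (- u) = (- (2 * real m * u)) / (- ?D)"
    using assms by (simp add: g_fun_def odd_denom_pow_def m_minus_n algebra_simps)
  also have "\<dots> = 2 * real m * u / ?D"
    by (rule minus_divide_divide)
  finally show ?thesis
    using pos by (simp add: pos_le_divide_eq)
qed

lemma le_g_fun_iff_upper_val:
  assumes "0 < b" "0 < d" "u = real n * b / (real m * d)" "u \<le> 1"
  shows "b \<le> g_fun m n (- u) \<longleftrightarrow> b + d - 1 \<le> upper_val b d"
proof -
  have u: "0 < u"
    using assms m_pos n_pos by simp
  have "2 * real m * u - b * (real m * u + real n - real p * u powr (real m / real p)) =
      real m * u * (upper_val b d - (b + d - 1))"
    using gap_eq_val_diff(2,3)[OF assms(1-3)] by (simp add: algebra_simps)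
  moreover have "0 < real m * u"
    using u m_pos by simp
  then have "0 \<le> real m * u * (upper_val b d - (b + d - 1)) \<longleftrightarrow> b + d - 1 \<le> upper_val b d"
    using mult_le_cancel_left_pos[of "real m * u" 0 "upper_val b d - (b + d - 1)"]
    by (simp only: mult_zero_right diff_ge_0_iff_ge)
  ultimately show ?thesis
    using le_g_fun_iff[OF u assms(4)] by (metis diff_ge_0_iff_ge)
qed

text \<open>At \<open>b = m / p\<close> one has \<open>r = 1\<close>, so
  \<open>lower_val b d\<close> equals the corner value \<open>b + d - 1\<close> and the criteria
  given by \<open>gap\<close> and by \<open>g_fun\<close> coincide. Hence the two curves meet at
  \<open>tau0\<close>.\<close>

lemma end_le_g_fun_iff:
  assumes "0 < u" "u \<le> 1"
  shows "real m / real p \<le> g_fun m n (- u) \<longleftrightarrow> - u \<le> tau0 m n"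
proof -
  have "real m / real p \<le> g_fun m n (- u) \<longleftrightarrow>
      real m / real p * (real m * u + real n - real p * u powr (real m / real p))
        \<le> real m / real p * (2 * real p * u)"
    using le_g_fun_iff[OF assms, of "real m / real p"] p_pos by (simp add: mult_ac)
  also have "\<dots> \<longleftrightarrow> real m * u + real n - real p * u powr (real m / real p) \<le> 2 * real p * u"
    using m_pos p_pos by (intro mult_le_cancel_left_pos) auto
  also have "\<dots> \<longleftrightarrow> - u \<le> tau0 m n"
    using le_tau0_iff[of u] assms by (simp add: real_m algebra_simps)
  finally show ?thesis .
qed

text \<open>This is the case \<open>u > 1\<close>, where the corner \<open>(1, 1)\<close> must win.
  After the bound on the K-term the claim is \<open>2 * m * d \<le> p * b + m\<close>, which follows
  from \<open>m * d < n * b \<le> p * b \<le> m\<close>.\<close>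

lemma lower_val_le_of_steep:
  assumes "0 < b" "real p * b \<le> real m" "real m * d < real n * b"
  shows "lower_val b d \<le> 1 + b - d"
proof -
  have "real m * (K_const m n * b powr (real m / real n)) \<le> real n * b"
    using K_const_term_le(1)[OF assms(1,2)] m_pos by (simp add: field_simps)
  moreover have "real n * b \<le> real p * b"
    using assms n_le_p by (intro mult_right_mono) auto
  moreover have "real m * b = real p * b + real n * b"
    by (simp add: real_m algebra_simps)
  moreover have "real m * lower_val b d =
      real m * d + real m * (K_const m n * b powr (real m / real n))"
    by (simp add: lower_val_def algebra_simps)
  moreover have "real m * (1 + b - d) = real m + real m * b - real m * d"
    by (simp add: algebra_simps)
  ultimately have "real m * lower_val b d \<le> real m * (1 + b - d)"
    using assms by linarith
  then show ?thesis
    using m_pos by simp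
qed

section \<open>Membership in the regions and the normalized case\<close>

lemma mem_region_A1_iff:
  assumes "0 < u"
  shows "(b, - u) \<in> region_A1 m n \<longleftrightarrow> 0 < b \<and> real p * b \<le> real m \<and> gap b u \<le> 0"
proof -
  have "b \<le> real m / real p \<longleftrightarrow> real p * b \<le> real m"
    using p_pos by (simp add: pos_le_divide_eq mult.commute)
  then show ?thesis
    using assms Lambda_fun_le_iff(1)[of b u] by (auto simp: region_A1_def m_minus_n)
qed

text \<open>The two pieces of \<open>region_B1\<close>, split at \<open>tau0\<close>, are regrouped
  by whether \<open>p * b \<le> m\<close>. Left of \<open>tau0\<close> the whole strip
  \<open>b \<le> m / p\<close> lies below \<open>g_fun\<close> and has \<open>gap \<ge> 0\<close>;
  beyond the strip, \<open>b \<le> g_fun\<close> forces \<open>- u \<le> tau0\<close>.\<close>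

lemma mem_region_B1_iff:
  assumes "0 < u"
  shows "(b, - u) \<in> region_B1 m n \<longleftrightarrow> 0 < b \<and> u \<le> 1 \<and>
    (if real p * b \<le> real m then 0 \<le> gap b u else b \<le> g_fun m n (- u))"
proof -
  have le: "b \<le> real m / real p \<longleftrightarrow> real p * b \<le> real m"
    using p_pos by (simp add: pos_le_divide_eq mult.commute)
  have "(b, - u) \<in> region_B1 m n \<longleftrightarrow> 0 < b \<and>
      (real p * b \<le> real m \<and> tau0 m n \<le> - u \<and> - u \<le> Lambda_fun m n b \<or>
       u \<le> 1 \<and> - u \<le> tau0 m n \<and> b \<le> g_fun m n (- u))"
    by (auto simp: region_B1_def m_minus_n le)
  moreover have "u \<le> 1" if "tau0 m n \<le> - u"
    using that tau0_range by linarith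
  moreover have "- u \<le> Lambda_fun m n b \<longleftrightarrow> 0 \<le> gap b u" if "0 < b" "real p * b \<le> real m"
    using that assms Lambda_fun_le_iff(2)[of b u] by simp
  moreover have "0 \<le> gap b u" if "0 < b" "real p * b \<le> real m" "- u \<le> tau0 m n"
    using that assms gap_nonneg_left_of_tau0[of b u] by simp
  ultimately show ?thesis
    using end_le_g_fun_iff[OF assms] le by (smt (verit))
qed

lemma mem_regions_negative:
  assumes "(b, t) \<in> region_A m n \<or> (b, t) \<in> region_B m n"
  shows "b * t < 0"
proof -
  have A1: "0 < b \<and> t < 0" if "(b, t) \<in> region_A1 m n" for b t
    using that by (auto simp: region_A1_def)
  have B1: "0 < b \<and> t < 0" if "(b, t) \<in> region_B1 m n" for b t
  proof -
    have "b \<le> real m / real p \<Longrightarrow> real p * b \<le> real m"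
      using p_pos by (simp add: pos_le_divide_eq mult.commute)
    then show ?thesis
      using that Lambda_fun_range(2)[of b] tau0_range(2)
      by (force simp: region_B1_def m_minus_n)
  qed
  show ?thesis
    using assms A1 B1 by (fastforce simp: region_A_def region_B_def mult_less_0_iff)
qed

lemma norm_cases_normalized:
  assumes "0 < b" "0 < d"
  shows "norm_cases m n (1, b, - d) (trinomial_norm m n (1, b, - d))"
proof -
  define u where "u = real n * b / (real m * d)"
  have u: "0 < u"
    using assms m_pos n_pos by (simp add: u_def)
  have t: "real n * b / (real m * - d) = - u"
    by (simp add: u_def)
  have u_le_1: "u \<le> 1 \<longleftrightarrow> real n * b \<le> real m * d"
    using assms m_pos by (simp add: u_def pos_divide_le_eq)
  have in_A: "(b, - u) \<in> region_A m n \<longleftrightarrow> (b, - u) \<in> region_A1 m n"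
    using assms by (auto simp: region_A_def region_A1_def)
  have in_B: "(b, - u) \<in> region_B m n \<longleftrightarrow> (b, - u) \<in> region_B1 m n"
    using assms u by (auto simp: region_B_def region_B1_def)
  have A_val: "\<bar>K_const m n * 1 * \<bar>b / 1\<bar> powr (real m / real n) - - d\<bar> = lower_val b d"
    using assms by (simp add: lower_val_def K_const_def)
  have B_val: "\<bar>K_const m (m - n) * - d * \<bar>b / - d\<bar> powr (real m / real (m - n)) - 1\<bar> = upper_val b d"
  proof -
    have "0 \<le> upper_val b d"
      using assms by (simp add: upper_val_def K_const_def)
    then show ?thesis
      using assms by (simp add: upper_val_def m_minus_n)
  qed
  have mu: "0 < real m * u"
    using u m_pos by simp
  have gap: "gap b u \<le> 0 \<longleftrightarrow> upper_val b d \<le> lower_val b d" "0 \<le> gap b u \<longleftrightarrow> lower_val b d \<le> upper_val b d"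
    using mult_le_cancel_left_pos[OF mu, of 0 "upper_val b d - lower_val b d"]
      mult_le_cancel_left_pos[OF mu, of "upper_val b d - lower_val b d" 0]
    unfolding gap_eq_val_diff(1)[OF assms u_def]
    by (simp_all only: mult_zero_right diff_ge_0_iff_ge diff_le_0_iff_le)
  have A: "(b, - u) \<in> region_A m n \<longleftrightarrow> real p * b \<le> real m \<and> u \<le> 1 \<and> upper_val b d \<le> lower_val b d"
    unfolding in_A mem_region_A1_iff[OF u] gap(1)[symmetric]
    using assms gap_one_nonneg[OF assms(1)] gap_le_iff[OF assms(1), of u 1] u by auto
  have B: "(b, - u) \<in> region_B m n \<longleftrightarrow> u \<le> 1 \<and>
      (if real p * b \<le> real m then lower_val b d \<le> upper_val b d else b + d - 1 \<le> upper_val b d)"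
    unfolding in_B mem_region_B1_iff[OF u] gap(2)
    using assms le_g_fun_iff_upper_val[OF assms u_def] by auto
  have "lower_val b d \<le> 1 + b - d" if "real p * b \<le> real m" "\<not> u \<le> 1"
    using lower_val_le_of_steep[OF assms(1)] that by (simp add: u_le_1)
  \<comment> \<open>\<open>\<bar>1 - d\<bar> + b\<close> is the larger of the corner values
    \<open>b + d - 1\<close> and \<open>1 + b - d\<close>. The four cases record which critical
    points lie in the square.\<close>
  then have "max (lower_max b d) (upper_max b d) =
    (if (b, - u) \<in> region_A m n then lower_val b d
     else if (b, - u) \<in> region_B m n then upper_val b d else \<bar>1 - d\<bar> + b)"
    using lower_max_ge[OF assms(1), of d] upper_max_ge[OF assms]
    unfolding A B lower_max_def upper_max_def u_le_1[symmetric]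
    by (cases "real p * b \<le> real m"; cases "u \<le> 1") auto
  \<comment> \<open>\<open>norm_cases\<close> demands agreement on the overlap of the
    regions.\<close>
  moreover have "lower_val b d = upper_val b d" if "(b, - u) \<in> region_A m n" "(b, - u) \<in> region_B m n"
    using that unfolding A B by auto
  ultimately show ?thesis
    using assms unfolding norm_cases_def prod.case Let_def t A_val B_val trinomial_norm_eq_max[OF assms] by auto
qed

end

section \<open>Reduction of general coefficients to the normalized case\<close>

lemma norm_cases_scale:
  assumes "norm_cases m n (a, b, c) v" "k \<noteq> 0"
  shows "norm_cases m n (k * a, k * b, k * c) (\<bar>k\<bar> * v)"
proof -
  have "k * b / (k * a) = b / a" "real n * (k * b) / (real m * (k * c)) = real n * b / (real m * c)"
      "k * b / (k * c) = b / c" "k * a * (k * b) * (k * c) \<noteq> 0 \<longleftrightarrow> a * b * c \<noteq> 0"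
      "k * b = 0 \<longleftrightarrow> b = 0" "k * a * (k * c) \<le> 0 \<longleftrightarrow> a * c \<le> 0"
    using assms(2) by (auto simp: mult_le_0_iff zero_le_mult_iff mult_less_0_iff zero_less_mult_iff)
  moreover have "\<bar>z * (k * x) * w - k * y\<bar> = \<bar>k\<bar> * \<bar>z * x * w - y\<bar>" for z x w y :: real
    by (simp add: abs_mult[symmetric] algebra_simps)
  moreover have "max \<bar>k * a\<bar> \<bar>k * c\<bar> = \<bar>k\<bar> * max \<bar>a\<bar> \<bar>c\<bar>"
    by (simp add: abs_mult max_mult_distrib_left)
  moreover have "\<bar>k * a + k * c\<bar> + \<bar>k * b\<bar> = \<bar>k\<bar> * (\<bar>a + c\<bar> + \<bar>b\<bar>)"
    by (simp add: abs_mult distrib_left flip: distrib_left)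
  ultimately show ?thesis
    using assms(1) unfolding norm_cases_def prod.case Let_def by metis
qed

lemma uminus_mem_region:
  "(- b, - t) \<in> region_A m n \<longleftrightarrow> (b, t) \<in> region_A m n"
  "(- b, - t) \<in> region_B m n \<longleftrightarrow> (b, t) \<in> region_B m n"
  by (force simp: region_A_def region_B_def image_iff)+

text \<open>Changing the sign of \<open>b\<close> negates both tested coordinates, which the
  symmetric regions absorb.\<close>

lemma norm_cases_uminus_mid:
  "norm_cases m n (a, - b, c) v \<longleftrightarrow> norm_cases m n (a, b, c) v"
  using uminus_mem_region[of "b / a" "real n * b / (real m * c)" m n]
  by (simp add: norm_cases_def Let_def)

context odd_split
begin

lemma norm_cases_trinomial_norm: "norm_cases m n (a, b, c) (trinomial_norm m n (a, b, c))"
proof (cases "a * c < 0 \<and> b \<noteq> 0")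
  case True
  define d where "d = - (c / a)"
  have "a \<noteq> 0" "0 < d" "0 < \<bar>b / a\<bar>"
    using True by (auto simp: d_def mult_less_0_iff divide_less_0_iff)
  have "norm_cases m n (1, b / a, - d) (trinomial_norm m n (1, b / a, - d))"
    using norm_cases_normalized[OF \<open>0 < \<bar>b / a\<bar>\<close> \<open>0 < d\<close>] odd_p even_m
      norm_cases_uminus_mid[of m n 1 "b / a" "- d"] trinomial_norm_uminus_mid[of m n 1 "b / a" "- d"]
    by (cases "0 \<le> b / a") (simp_all add: m_minus_n del: abs_divide)
  then show ?thesis
    using norm_cases_scale[of m n 1 "b / a" "- d" _ a] \<open>a \<noteq> 0\<close>
      trinomial_norm_scale[of m n a 1 "b / a" "- d"]
    by (simp add: d_def)
next
  case False
  have not_in: "\<not> (a * b * c \<noteq> 0 \<and> (b / a, real n * b / (real m * c)) \<in> region_A m n)"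
    "\<not> (a * b * c \<noteq> 0 \<and> (b / a, real n * b / (real m * c)) \<in> region_B m n)"
  proof -
    \<comment> \<open>The product of the tested coordinates has the sign of \<open>a * c\<close>
      when \<open>b\<close> is nonzero, while it is negative throughout the regions.\<close>
    have "b / a * (real n * b / (real m * c)) = real n * b\<^sup>2 / (real m * (a * c))"
      by (simp add: power2_eq_square mult_ac)
    then have "0 \<le> b / a * (real n * b / (real m * c))" if "a * b * c \<noteq> 0"
      using False that by (auto intro!: divide_nonneg_nonneg mult_nonneg_nonneg[of "real m" "a * c"])
    then show "\<not> (a * b * c \<noteq> 0 \<and> (b / a, real n * b / (real m * c)) \<in> region_A m n)"
      "\<not> (a * b * c \<noteq> 0 \<and> (b / a, real n * b / (real m * c)) \<in> region_B m n)"
      using mem_regions_negative[of "b / a" "real n * b / (real m * c)"] by auto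
  qed
  have pow: "0 \<le> x ^ m" "\<bar>x ^ k\<bar> \<le> 1" if "x \<in> {-1..1}" for x :: real and k
  proof -
    have "\<bar>x\<bar> \<le> 1"
      using that by auto
    then show "\<bar>x ^ k\<bar> \<le> 1"
      by (simp add: power_abs power_le_one)
  qed (use even_m in \<open>simp add: zero_le_even_power\<close>)
  have mid: "\<bar>b * x ^ (m - n) * y ^ n\<bar> \<le> \<bar>b\<bar>" if "x \<in> {-1..1}" "y \<in> {-1..1}" for x y
    using pow(2)[OF that(1), of "m - n"] pow(2)[OF that(2), of n]
    by (simp add: abs_mult mult.assoc mult_left_le mult_le_one)
  have outer: "\<bar>e * x ^ m\<bar> \<le> \<bar>e\<bar>" if "x \<in> {-1..1}" for e x :: real
    using pow(2)[OF that, of m] by (simp add: abs_mult mult_left_le)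
  have "trinomial_norm m n (a, b, c) = (if b = 0 \<and> a * c \<le> 0 then max \<bar>a\<bar> \<bar>c\<bar> else \<bar>a + c\<bar> + \<bar>b\<bar>)"
  proof (cases "b = 0 \<and> a * c \<le> 0")
    case True
    have bound: "\<bar>a * x ^ m + c * y ^ m\<bar> \<le> max \<bar>a\<bar> \<bar>c\<bar>" if "x \<in> {-1..1}" "y \<in> {-1..1}" for x y
    proof -
      have "a * c * (x ^ m * y ^ m) \<le> 0"
        by (rule mult_nonpos_nonneg) (use True pow(1)[OF that(1)] pow(1)[OF that(2)] in simp_all)
      then have "a * x ^ m * (c * y ^ m) \<le> 0"
        by (simp only: mult_ac)
      then have "0 \<le> a * x ^ m \<and> c * y ^ m \<le> 0 \<or> a * x ^ m \<le> 0 \<and> 0 \<le> c * y ^ m"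
        by (simp only: mult_le_0_iff)
      then show ?thesis
        using outer[OF that(1), of a] outer[OF that(2), of c] by linarith
    qed
    have "trinomial_norm m n (a, b, c) = max \<bar>a\<bar> \<bar>c\<bar>"
      if "x \<in> {-1..1}" "y \<in> {-1..1}" "\<bar>a * x ^ m + c * y ^ m\<bar> = max \<bar>a\<bar> \<bar>c\<bar>" for x y
      using that True bound by (intro trinomial_norm_eqI[where x = x and y = y]) simp_all
    from this[of 1 0] this[of 0 1] have "trinomial_norm m n (a, b, c) = max \<bar>a\<bar> \<bar>c\<bar>"
      using m_pos by (cases "\<bar>a\<bar> \<le> \<bar>c\<bar>") (simp_all add: power_0_left)
    then show ?thesis
      using True by simp
  next
    case nonzero: False
    \<comment> \<open>The remaining cases all have \<open>a * c \<ge> 0\<close>.\<close>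
    have ac: "\<bar>a\<bar> + \<bar>c\<bar> = \<bar>a + c\<bar>"
      using False nonzero by (auto simp: mult_less_0_iff mult_le_0_iff)
    have "\<bar>a * x ^ m + b * x ^ (m - n) * y ^ n + c * y ^ m\<bar> \<le> \<bar>a + c\<bar> + \<bar>b\<bar>"
      if "x \<in> {-1..1}" "y \<in> {-1..1}" for x y
      using outer[OF that(1), of a] outer[OF that(2), of c] mid[OF that] ac by linarith
    \<comment> \<open>Sharpness at \<open>(1, 1)\<close> or \<open>(-1, 1)\<close>, whichever gives
      the mixed term the sign of \<open>a + c\<close>.\<close>
    moreover have "\<exists>x\<in>{-1..1}. \<bar>a * x ^ m + b * x ^ (m - n) * 1 ^ n + c * 1 ^ m\<bar> = \<bar>a + c\<bar> + \<bar>b\<bar>"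
    proof (cases "0 \<le> (a + c) * b")
      case True
      then show ?thesis
        by (intro bexI[of _ 1]) (auto simp: zero_le_mult_iff)
    next
      case False
      then show ?thesis
        using even_m odd_p by (intro bexI[of _ "-1"]) (auto simp: m_minus_n zero_le_mult_iff)
    qed
    ultimately show ?thesis
      using nonzero by (auto intro!: trinomial_norm_eqI[where y = 1])
  qed
  then show ?thesis
    using not_in by (auto simp: norm_cases_def Let_def)
qed

end

theorem theorem2p5:
  fixes m n :: nat
  assumes "0 < n" and "n < m" and "even m" and "odd n"
  shows "(2 * n \<le> m \<longrightarrow>
            (\<forall>a b c :: real. norm_cases m n (a, b, c) (trinomial_norm m n (a, b, c)))) \<and>
         (m < 2 * n \<longrightarrow>
            (\<forall>a b c :: real.
               trinomial_norm m n (a, b, c) = trinomial_norm m (m - n) (c, b, a) \<and>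
               norm_cases m (m - n) (c, b, a) (trinomial_norm m (m - n) (c, b, a))))"
proof (intro conjI impI allI)
  fix a b c :: real
  assume "2 * n \<le> m"
  then interpret odd_split m n "m - n"
    using assms by unfold_locales auto
  show "norm_cases m n (a, b, c) (trinomial_norm m n (a, b, c))"
    by (rule norm_cases_trinomial_norm)
next
  fix a b c :: real
  assume "m < 2 * n"
  \<comment> \<open>Here \<open>m - n < n\<close>, so the exponents trade places; exchanging
    \<open>x\<close> and \<open>y\<close> does the same to the norm.\<close>
  then interpret odd_split m "m - n" n
    using assms by unfold_locales auto
  show "norm_cases m (m - n) (c, b, a) (trinomial_norm m (m - n) (c, b, a))"
    by (rule norm_cases_trinomial_norm)
  show "trinomial_norm m n (a, b, c) = trinomial_norm m (m - n) (c, b, a)"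
    using assms by (intro trinomial_norm_swap) simp
qed

end
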